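(* Let $p\in[1,+\infty]$. For every bivariate copula $C$, $$\mu_p(C)\;\le\;\frac{2}{c_p}\,\sigma_p(C).$$ Moreover, for every $p\in[1,+\infty]$ the constant $2/c_p$ is sharp, i.e. it cannot be replaced by any smaller constant for which the inequality holds for all copulas $C$.
   Context: A (bivariate) copula is a function $C:[0,1]^2\to[0,1]$ with $C(t,0)=C(0,t)=0$, $C(t,1)=C(1,t)=t$ for all $t\in[0,1]$, and $C(u',v')-C(u,v')-C(u',v)+C(u,v)\ge 0$ whenever $u\le u'$, $v\le v'$ in $[0,1]$. The transpose is $C^t(u,v)=C(v,u)$ and $\Pi(u,v)=uv$ is the product copula. For $p\in[1,\infty)$, $d_p(A,B)=\left(\int_{[0,1]^2}|A(u,v)-B(u,v)|^p\,du\,dv\right)^{1/p}$, and $d_\infty(A,B)=\sup_{(u,v)\in[0,1]^2}|A(u,v)-B(u,v)|$. The non-exchangeability measure is $\mu_p(C)=d_p(C,C^t)$. The Schweizer–Wolff dependence measure is $\sigma_p(C)=c_p\,d_p(C,\Pi)$, where $c_p=\left(\frac{(2p+2)!}{2\,(p!)^2}\right)^{1/p}$ for $p\in[1,\infty)$ (with $x!=\Gamma(x+1)$ for non-integer $x$) and $c_\infty=4$. *)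

theory Defs
  imports "HOL-Analysis.Analysis"
begin

text \<open>
  Functions on the unit square are represented by total functions
  \<open>real \<Rightarrow> real \<Rightarrow> real\<close>; values outside the square are irrelevant to every definition below.
\<close>

definition is_copula :: "(real \<Rightarrow> real \<Rightarrow> real) \<Rightarrow> bool" where
  "is_copula C \<longleftrightarrow>
     (\<forall>u\<in>{0..1}. \<forall>v\<in>{0..1}. C u v \<in> {0..1}) \<and>
     (\<forall>t\<in>{0..1}. C t 0 = 0 \<and> C 0 t = 0 \<and> C t 1 = t \<and> C 1 t = t) \<and>
     (\<forall>u\<in>{0..1}. \<forall>u'\<in>{0..1}. \<forall>v\<in>{0..1}. \<forall>v'\<in>{0..1}. u \<le> u' \<longrightarrow> v \<le> v' \<longrightarrow>
        C u' v' - C u v' - C u' v + C u v \<ge> 0)"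

definition transpose_copula :: "(real \<Rightarrow> real \<Rightarrow> real) \<Rightarrow> real \<Rightarrow> real \<Rightarrow> real" where
  "transpose_copula C = (\<lambda>u v. C v u)"

definition product_copula :: "real \<Rightarrow> real \<Rightarrow> real" where
  "product_copula = (\<lambda>u v. u * v)"

text \<open>
  The exponent is an extended real; only \<open>1 \<le> p\<close> (including \<open>p = \<infinity>\<close>) is meaningful.
\<close>

definition copula_dist :: "ereal \<Rightarrow> (real \<Rightarrow> real \<Rightarrow> real) \<Rightarrow> (real \<Rightarrow> real \<Rightarrow> real) \<Rightarrow> real" where
  "copula_dist p A B =
     (if p = \<infinity> then (SUP (u, v)\<in>{0..1} \<times> {0..1}. \<bar>A u v - B u v\<bar>)
      else (set_lebesgue_integral lborel ({0..1} \<times> {0..1})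
              (\<lambda>(u, v). \<bar>A u v - B u v\<bar> powr real_of_ereal p)) powr (1 / real_of_ereal p))"

definition nonexch_measure :: "ereal \<Rightarrow> (real \<Rightarrow> real \<Rightarrow> real) \<Rightarrow> real" where
  "nonexch_measure p C = copula_dist p C (transpose_copula C)"

text \<open>Factorials of non-integers are read as \<open>x! = Gamma (x + 1)\<close>.\<close>

definition sw_const :: "ereal \<Rightarrow> real" where
  "sw_const p =
     (if p = \<infinity> then 4
      else (let r = real_of_ereal p in
              (Gamma ((2 * r + 2) + 1) / (2 * (Gamma (r + 1))\<^sup>2)) powr (1 / r)))"

definition sw_measure :: "ereal \<Rightarrow> (real \<Rightarrow> real \<Rightarrow> real) \<Rightarrow> real" where
  "sw_measure p C = sw_const p * copula_dist p C product_copula"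

end

theory Submission
  imports Defs
begin

text \<open>
  Since \<open>\<Pi>\<close> is symmetric, \<open>C\<close> and its transpose are equally far from \<open>\<Pi>\<close>, so the bound is the
  triangle inequality; for \<open>p < \<infinity>\<close> convexity of \<open>x \<mapsto> x\<^sup>p\<close> is enough. Equality holds whenever
  \<open>C - \<Pi>\<close> is antisymmetric, for instance for a small multiple of \<open>u (1 - u) v (1 - v) (u - v)\<close>.
\<close>

section \<open>Monotonicity and Lipschitz continuity of copulas\<close>

text \<open>Apply the rectangle inequality over \<open>[u, u']\<close> to the strips below and above
  height \<open>v\<close>; the boundary values turn these into the lower and the upper
  bound.\<close>

lemma copula_mono1:
  assumes "is_copula C" "0 \<le> u" "u \<le> u'" "u' \<le> 1" "0 \<le> v" "v \<le> 1"
  shows "0 \<le> C u' v - C u v" "C u' v - C u v \<le> u' - u"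
proof -
  have rect: "C u' w' - C u w' - C u' w + C u w \<ge> 0" if "0 \<le> w" "w \<le> w'" "w' \<le> 1" for w w'
    using assms that unfolding is_copula_def by auto
  have "C u 0 = 0" "C u' 0 = 0" "C u 1 = u" "C u' 1 = u'"
    using assms unfolding is_copula_def by auto
  then show "0 \<le> C u' v - C u v" "C u' v - C u v \<le> u' - u"
    using rect[of 0 v] rect[of v 1] assms by auto
qed

lemma is_copula_transpose:
  assumes "is_copula C" shows "is_copula (transpose_copula C)"
  unfolding is_copula_def transpose_copula_def
proof (intro conjI ballI impI)
  fix u u' v v' :: real
  assume "u \<in> {0..1}" "u' \<in> {0..1}" "v \<in> {0..1}" "v' \<in> {0..1}" "u \<le> u'" "v \<le> v'"
  then have "C v' u' - C v u' - C v' u + C v u \<ge> 0"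
    using assms unfolding is_copula_def by blast
  then show "0 \<le> C v' u' - C v' u - C v u' + C v u" by simp
qed (use assms in \<open>auto simp: is_copula_def\<close>)

lemma copula_lipschitz1:
  assumes "is_copula C" "u \<in> {0..1}" "u' \<in> {0..1}" "v \<in> {0..1}"
  shows "\<bar>C u v - C u' v\<bar> \<le> \<bar>u - u'\<bar>"
  using copula_mono1[of C u u' v] copula_mono1[of C u' u v] assms
  by (cases "u \<le> u'") auto

lemma copula_lipschitz:
  assumes "is_copula C" "u \<in> {0..1}" "u' \<in> {0..1}" "v \<in> {0..1}" "v' \<in> {0..1}"
  shows "\<bar>C u v - C u' v'\<bar> \<le> \<bar>u - u'\<bar> + \<bar>v - v'\<bar>"
proof -
  \<comment> \<open>The second variable is the first variable of the transpose.\<close>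
  have "\<bar>C u' v - C u' v'\<bar> \<le> \<bar>v - v'\<bar>"
    using copula_lipschitz1[OF is_copula_transpose, of C v v' u'] assms
    by (simp add: transpose_copula_def)
  then show ?thesis using copula_lipschitz1[of C u u' v] assms by linarith
qed

lemma continuous_on_copula:
  assumes "is_copula C"
  shows "continuous_on ({0..1} \<times> {0..1}) (\<lambda>(u, v). C u v)"
proof -
  \<comment> \<open>Each coordinate difference is at most the Euclidean distance, whence the
    constant 2.\<close>
  have "2-lipschitz_on ({0..1} \<times> {0..1}) (\<lambda>(u, v). C u v)"
  proof (rule lipschitz_onI)
    fix x y :: "real \<times> real"
    assume "x \<in> {0..1} \<times> {0..1}" "y \<in> {0..1} \<times> {0..1}"
    then have "\<bar>C (fst x) (snd x) - C (fst y) (snd y)\<bar> \<le> \<bar>fst x - fst y\<bar> + \<bar>snd x - snd y\<bar>"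
      using copula_lipschitz[OF assms] by auto
    then show "dist (case x of (u, v) \<Rightarrow> C u v) (case y of (u, v) \<Rightarrow> C u v) \<le> 2 * dist x y"
      using dist_fst_le[of x y] dist_snd_le[of x y] by (simp add: dist_real_def case_prod_beta)
  qed simp
  then show ?thesis by (rule lipschitz_on_continuous_on)
qed

section \<open>Integrals over the unit square\<close>

text \<open>The base vanishes wherever \<open>A\<close> and \<open>B\<close> agree; a positive
  exponent keeps \<open>powr\<close> continuous there.\<close>

lemma continuous_on_abs_diff_powr:
  fixes A B :: "real \<Rightarrow> real \<Rightarrow> real"
  assumes "continuous_on S (\<lambda>(u, v). A u v)" "continuous_on S (\<lambda>(u, v). B u v)" "0 < r"
  shows "continuous_on S (\<lambda>(u, v). \<bar>A u v - B u v\<bar> powr r)"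
  using assms unfolding case_prod_beta
  by (intro continuous_on_powr' continuous_intros) auto

lemma continuous_on_product_copula: "continuous_on S (\<lambda>(u, v). product_copula u v)"
  unfolding product_copula_def case_prod_beta by (intro continuous_intros)

lemma set_integrable_unit_square:
  fixes f :: "real \<times> real \<Rightarrow> real"
  assumes "continuous_on ({0..1} \<times> {0..1}) f"
  shows "set_integrable lborel ({0..1} \<times> {0..1}) f"
  using borel_integrable_compact[OF compact_Times[OF compact_Icc compact_Icc] assms]
  by (simp add: set_integrable_def scaleR_conv_of_real indicator_def if_distrib cong: if_cong)

text \<open>Invariance of the product measure under swapping coordinates; the square is symmetric.
  It makes \<open>C\<close> and its transpose equally far from the product copula.\<close>

lemma set_integral_unit_square_swap:
  fixes f :: "real \<Rightarrow> real \<Rightarrow> real"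
  assumes "continuous_on ({0..1} \<times> {0..1}) (\<lambda>(u, v). f u v)"
  shows "set_lebesgue_integral lborel ({0..1} \<times> {0..1}) (\<lambda>(u, v). f v u) =
         set_lebesgue_integral lborel ({0..1} \<times> {0..1}) (\<lambda>(u, v). f u v)"
proof -
  let ?g = "\<lambda>x :: real \<times> real. indicator ({0..1} \<times> {0..1}) x *\<^sub>R (\<lambda>(u, v). f u v) x"
  have "integrable lborel ?g"
    using set_integrable_unit_square[OF assms] unfolding set_integrable_def .
  then have "?g \<in> borel_measurable (lborel \<Otimes>\<^sub>M lborel)"
    unfolding lborel_prod by (rule borel_measurable_integrable)
  from lborel_pair.integral_product_swap[OF this]
  have "(\<integral>(x, y). ?g (y, x) \<partial>lborel) = (\<integral>x. ?g x \<partial>lborel)"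
    unfolding lborel_prod .
  moreover have "(\<integral>(x, y). ?g (y, x) \<partial>lborel) =
      set_lebesgue_integral lborel ({0..1} \<times> {0..1}) (\<lambda>(u, v). f v u)"
    unfolding set_lebesgue_integral_def
    by (intro Bochner_Integration.integral_cong) (auto simp: indicator_def)
  ultimately show ?thesis unfolding set_lebesgue_integral_def by simp
qed

lemma set_integral_abs_powr_nonneg:
  fixes f :: "real \<Rightarrow> real \<Rightarrow> real"
  shows "0 \<le> set_lebesgue_integral lborel S (\<lambda>(u, v). \<bar>f u v\<bar> powr r)"
  unfolding set_lebesgue_integral_def
  by (rule Bochner_Integration.integral_nonneg) (simp add: case_prod_beta)

section \<open>The inequality with constant 2 for the unscaled distances\<close>

lemma sw_const_pos:
  assumes "1 \<le> p" shows "0 < sw_const p"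
proof (cases p)
  case (real r)
  then have "1 \<le> r" using assms by simp
  then have "0 < Gamma (2 * r + 2 + 1)" "0 < Gamma (r + 1)"
    by (auto intro!: Gamma_real_pos)
  then show ?thesis using real by (simp add: sw_const_def Let_def)
qed (use assms in \<open>auto simp: sw_const_def\<close>)

lemma powr_abs_add_le:
  fixes a b :: real
  assumes "1 \<le> r"
  shows "\<bar>a + b\<bar> powr r \<le> 2 powr (r - 1) * (\<bar>a\<bar> powr r + \<bar>b\<bar> powr r)"
\<comment> \<open>Convexity is invoked only for nonzero \<open>a\<close> and \<open>b\<close>;
  otherwise the claim reduces to \<open>2 powr (r - 1) \<ge> 1\<close>.\<close>
proof (cases "a = 0 \<or> b = 0")
  case True
  have "1 \<le> (2::real) powr (r - 1)" using assms by (intro ge_one_powr_ge_zero) auto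
  from mult_right_mono[OF this, of "\<bar>a\<bar> powr r + \<bar>b\<bar> powr r"] True show ?thesis by auto
next
  case False
  \<comment> \<open>The sum is twice a midpoint, with weights written in the shape of
    \<open>convex_onD\<close>.\<close>
  have "\<bar>a + b\<bar> powr r \<le> (2 * ((1 - 1/2) *\<^sub>R \<bar>a\<bar> + (1/2) *\<^sub>R \<bar>b\<bar>)) powr r"
    using assms by (intro powr_mono2) auto
  also have "\<dots> = 2 powr r * ((1 - 1/2) *\<^sub>R \<bar>a\<bar> + (1/2) *\<^sub>R \<bar>b\<bar>) powr r"
    by (rule powr_mult)
  also have "\<dots> \<le> 2 powr r * ((1 - 1/2) * \<bar>a\<bar> powr r + (1/2) * \<bar>b\<bar> powr r)"
    using convex_onD[OF powr_convex[OF assms], of "1/2" "\<bar>a\<bar>" "\<bar>b\<bar>"] False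
    by (intro mult_left_mono) auto
  also have "\<dots> = 2 powr (r - 1) * (\<bar>a\<bar> powr r + \<bar>b\<bar> powr r)"
    by (simp add: powr_diff field_simps)
  finally show ?thesis .
qed

text \<open>For finite \<open>p\<close> the two integrals produced by convexity coincide, so the
  factor \<open>2 powr (r - 1)\<close> doubles to \<open>2 powr r\<close>, whose \<open>r\<close>-th
  root is 2.\<close>

lemma nonexch_measure_le:
  assumes "1 \<le> p" "is_copula C"
  shows "nonexch_measure p C \<le> 2 * copula_dist p C product_copula"
proof (cases p)
  case (real r)
  then have r: "1 \<le> r" using assms by simp
  let ?Q = "{0..1} \<times> {0..1} :: (real \<times> real) set"
  let ?T = "transpose_copula C"
  let ?f = "\<lambda>(u, v). \<bar>C u v - product_copula u v\<bar> powr r"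
  let ?g = "\<lambda>(u, v). \<bar>?T u v - product_copula u v\<bar> powr r"
  let ?h = "\<lambda>(u, v). \<bar>C u v - ?T u v\<bar> powr r"
  have C: "continuous_on ?Q (\<lambda>(u, v). C u v)" and T: "continuous_on ?Q (\<lambda>(u, v). ?T u v)"
    using continuous_on_copula assms is_copula_transpose by blast+
  have cf: "continuous_on ?Q ?f" and cg: "continuous_on ?Q ?g" and ch: "continuous_on ?Q ?h"
    using continuous_on_abs_diff_powr[OF C continuous_on_product_copula]
      continuous_on_abs_diff_powr[OF T continuous_on_product_copula]
      continuous_on_abs_diff_powr[OF C T] r by auto
  note int = cf[THEN set_integrable_unit_square] cg[THEN set_integrable_unit_square]
    ch[THEN set_integrable_unit_square]
  have "set_lebesgue_integral lborel ?Q ?h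
      \<le> set_lebesgue_integral lborel ?Q (\<lambda>x. 2 powr (r - 1) * (?f x + ?g x))"
  proof (rule set_integral_mono)
    fix x :: "real \<times> real"
    show "?h x \<le> 2 powr (r - 1) * (?f x + ?g x)"
      using powr_abs_add_le[OF r, of "C (fst x) (snd x) - product_copula (fst x) (snd x)"
          "product_copula (fst x) (snd x) - ?T (fst x) (snd x)"]
      by (simp add: case_prod_beta abs_minus_commute)
  qed (use int in auto)
  also have "\<dots> = 2 powr (r - 1) *
      (set_lebesgue_integral lborel ?Q ?f + set_lebesgue_integral lborel ?Q ?g)"
    using int by simp
  also have "set_lebesgue_integral lborel ?Q ?g = set_lebesgue_integral lborel ?Q ?f"
    using set_integral_unit_square_swap[OF cf]
    by (simp add: transpose_copula_def product_copula_def mult.commute)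
  also have "2 powr (r - 1) *
      (set_lebesgue_integral lborel ?Q ?f + set_lebesgue_integral lborel ?Q ?f) =
      2 powr r * set_lebesgue_integral lborel ?Q ?f"
    by (simp add: powr_diff)
  finally have le: "set_lebesgue_integral lborel ?Q ?h \<le> \<dots>" .
  have nonneg: "0 \<le> set_lebesgue_integral lborel ?Q ?h" "0 \<le> set_lebesgue_integral lborel ?Q ?f"
    by (simp_all add: set_integral_abs_powr_nonneg)
  have "set_lebesgue_integral lborel ?Q ?h powr (1 / r)
      \<le> (2 powr r * set_lebesgue_integral lborel ?Q ?f) powr (1 / r)"
    using le nonneg r by (intro powr_mono2) auto
  also have "\<dots> = 2 * set_lebesgue_integral lborel ?Q ?f powr (1 / r)"
    using nonneg r by (simp add: powr_mult powr_powr)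
  finally show ?thesis
    using real by (simp add: nonexch_measure_def copula_dist_def)
next
  case PInf
  let ?d = "\<lambda>(u, v). \<bar>C u v - product_copula u v\<bar>"
  \<comment> \<open>A real supremum bounds its members only for a set bounded above; compactness
    provides this.\<close>
  have bdd: "bdd_above (?d ` ({0..1} \<times> {0..1}))"
    using continuous_on_copula[OF assms(2)] continuous_on_product_copula
    unfolding case_prod_beta
    by (intro compact_imp_bounded[THEN bounded_imp_bdd_above] compact_continuous_image
        continuous_intros compact_Times compact_Icc) auto
  \<comment> \<open>Pass through \<open>u * v = v * u\<close>, using the supremum at
    \<open>(u, v)\<close> and at the reflected point.\<close>
  have "\<bar>C u v - C v u\<bar> \<le> 2 * (SUP x\<in>{0..1} \<times> {0..1}. ?d x)"
    if "u \<in> {0..1}" "v \<in> {0..1}" for u v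
  proof -
    have "?d (u, v) \<le> (SUP x\<in>{0..1} \<times> {0..1}. ?d x)"
      using that by (intro cSUP_upper[OF _ bdd]) auto
    moreover have "?d (v, u) \<le> (SUP x\<in>{0..1} \<times> {0..1}. ?d x)"
      using that by (intro cSUP_upper[OF _ bdd]) auto
    ultimately show ?thesis by (simp add: product_copula_def mult.commute)
  qed
  then show ?thesis
    using PInf unfolding nonexch_measure_def copula_dist_def
    by (auto simp: transpose_copula_def intro!: cSUP_least)
qed (use assms in auto)

section \<open>A copula attaining equality, and sharpness\<close>

text \<open>The factors \<open>u * (1 - u) * v * (1 - v)\<close> preserve the boundary values,
  \<open>u - v\<close> makes the perturbation antisymmetric, and halving keeps rectangle volumes
  nonnegative.\<close>

definition antisym_copula :: "real \<Rightarrow> real \<Rightarrow> real" where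
  "antisym_copula u v = u * v + u * (1 - u) * v * (1 - v) * (u - v) / 2"

text \<open>The range condition follows from the rectangles \<open>[0, u] \<times> [0, v]\<close>
  and \<open>[0, u] \<times> [v, 1]\<close>, which give
  \<open>0 \<le> C u v \<le> u\<close>.\<close>

lemma is_copulaI:
  assumes bdry: "\<And>t. t \<in> {0..1} \<Longrightarrow> C t 0 = 0 \<and> C 0 t = 0 \<and> C t 1 = t \<and> C 1 t = t"
    and rect: "\<And>u u' v v'. 0 \<le> u \<Longrightarrow> u \<le> u' \<Longrightarrow> u' \<le> 1 \<Longrightarrow> 0 \<le> v \<Longrightarrow> v \<le> v' \<Longrightarrow> v' \<le> 1 \<Longrightarrow>
      C u' v' - C u v' - C u' v + C u v \<ge> 0"
  shows "is_copula C"
proof -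
  have "C u v \<in> {0..1}" if "u \<in> {0..1}" "v \<in> {0..1}" for u v
    using rect[of 0 u 0 v] rect[of 0 u v 1] bdry[of u] bdry[of v] bdry[of 0] bdry[of 1] that
    by auto
  then show ?thesis unfolding is_copula_def using assms by auto
qed

text \<open>
  The perturbation is \<open>(a(u) b(v) - b(u) a(v)) / 2\<close> with \<open>a(t) = t\<^sup>2 (1 - t)\<close> and
  \<open>b(t) = t (1 - t)\<close>; both are \<open>1\<close>-Lipschitz on \<open>[0,1]\<close>, so the mass of \<open>\<Pi>\<close> dominates it.
\<close>
lemma is_copula_antisym_copula: "is_copula antisym_copula"
proof (rule is_copulaI)
  fix u u' v v' :: real
  assume uv: "0 \<le> u" "u \<le> u'" "u' \<le> 1" "0 \<le> v" "v \<le> v'" "v' \<le> 1"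
  define a b where "a t = t\<^sup>2 * (1 - t)" and "b t = t * (1 - t)" for t :: real
  have lip: "\<bar>a t - a s\<bar> \<le> t - s" "\<bar>b t - b s\<bar> \<le> t - s" if "0 \<le> s" "s \<le> t" "t \<le> 1" for s t
  proof -
    have b: "b t - b s = (t - s) * (1 - t - s)"
      by (simp add: b_def algebra_simps)
    have a: "a t - a s = (t - s) * (t * (1 - t) + s * (1 - s) - s * t)"
      by (simp add: a_def algebra_simps power2_eq_square)
    \<comment> \<open>These bounds place the cofactor of \<open>t - s\<close> in
      \<open>a t - a s\<close> between -1 and 1/2.\<close>
    have q: "0 \<le> x * (1 - x)" "x * (1 - x) \<le> 1 / 4" if "0 \<le> x" "x \<le> 1" for x :: real
      using that zero_le_power2[of "x - 1/2"] mult_left_le[of x x]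
      by (auto simp: power2_eq_square algebra_simps)
    have "0 \<le> s * t" "s * t \<le> 1" using that by (auto intro: mult_le_one)
    then have "\<bar>t * (1 - t) + s * (1 - s) - s * t\<bar> \<le> 1"
      using q[of s] q[of t] that by linarith
    then show "\<bar>a t - a s\<bar> \<le> t - s"
      unfolding a abs_mult using that by (simp add: mult_left_le)
    have "\<bar>1 - t - s\<bar> \<le> 1" using that by linarith
    then show "\<bar>b t - b s\<bar> \<le> t - s"
      unfolding b abs_mult using that by (simp add: mult_left_le)
  qed
  \<comment> \<open>The rectangle difference of a function \<open>a(u) b(v)\<close> is the product
    of the one-variable differences.\<close>
  have "\<bar>(a u' - a u) * (b v' - b v)\<bar> \<le> (u' - u) * (v' - v)"
       "\<bar>(b u' - b u) * (a v' - a v)\<bar> \<le> (u' - u) * (v' - v)"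
    unfolding abs_mult using uv lip by (auto intro!: mult_mono)
  moreover have "0 \<le> m + (x - y) / 2" if "\<bar>x\<bar> \<le> m" "\<bar>y\<bar> \<le> m" for x y m :: real
    using that by (simp add: abs_le_iff field_simps)
  ultimately have "0 \<le> (u' - u) * (v' - v)
      + ((a u' - a u) * (b v' - b v) - (b u' - b u) * (a v' - a v)) / 2"
    by blast
  also have "\<dots> = antisym_copula u' v' - antisym_copula u v' - antisym_copula u' v
      + antisym_copula u v"
    by (simp add: antisym_copula_def a_def b_def field_simps power2_eq_square)
  finally show "0 \<le> antisym_copula u' v' - antisym_copula u v' - antisym_copula u' v
      + antisym_copula u v" .
qed (simp add: antisym_copula_def)

text \<open>The deviations of the copula and its transpose from the product copula are opposite, so
  the triangle inequality is an equality at every point.\<close>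

lemma antisym_copula_minus_transpose:
  "antisym_copula u v - transpose_copula antisym_copula u v
     = 2 * (antisym_copula u v - product_copula u v)"
  by (simp add: antisym_copula_def transpose_copula_def product_copula_def field_simps)

lemma nonexch_measure_antisym_copula:
  assumes "1 \<le> p"
  shows "2 * copula_dist p antisym_copula product_copula \<le> nonexch_measure p antisym_copula"
proof (cases p)
  case (real r)
  then have r: "1 \<le> r" using assms by simp
  let ?I = "set_lebesgue_integral lborel ({0..1} \<times> {0..1})
      (\<lambda>(u, v). \<bar>antisym_copula u v - product_copula u v\<bar> powr r)"
  have "\<bar>antisym_copula u v - transpose_copula antisym_copula u v\<bar> powr r
      = 2 powr r * \<bar>antisym_copula u v - product_copula u v\<bar> powr r" for u v
    unfolding antisym_copula_minus_transpose abs_mult by (simp add: powr_mult)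
  then have "set_lebesgue_integral lborel ({0..1} \<times> {0..1})
      (\<lambda>(u, v). \<bar>antisym_copula u v - transpose_copula antisym_copula u v\<bar> powr r)
      = 2 powr r * ?I"
    by (simp add: case_prod_beta set_lebesgue_integral_def mult.left_commute)
  moreover have "(2 powr r * ?I) powr (1 / r) = 2 * ?I powr (1 / r)"
    using r by (simp add: powr_mult powr_powr)
  ultimately show ?thesis
    using real by (simp add: nonexch_measure_def copula_dist_def)
next
  case PInf
  let ?d = "\<lambda>(u, v). \<bar>antisym_copula u v - transpose_copula antisym_copula u v\<bar>"
  have bdd: "bdd_above (?d ` ({0..1} \<times> {0..1}))"
    using continuous_on_copula[OF is_copula_antisym_copula]
      continuous_on_copula[OF is_copula_transpose[OF is_copula_antisym_copula]]
    unfolding case_prod_beta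
    by (intro compact_imp_bounded[THEN bounded_imp_bdd_above] compact_continuous_image
        continuous_intros compact_Times compact_Icc) auto
  have "(SUP (u, v)\<in>{0..1} \<times> {0..1}. \<bar>antisym_copula u v - product_copula u v\<bar>)
      \<le> (SUP x\<in>{0..1} \<times> {0..1}. ?d x) / 2"
  proof (rule cSUP_least)
    fix x :: "real \<times> real" assume "x \<in> {0..1} \<times> {0..1}"
    then have "?d x \<le> (SUP x\<in>{0..1} \<times> {0..1}. ?d x)" by (rule cSUP_upper[OF _ bdd])
    moreover have "?d x = 2 * (case x of (u, v) \<Rightarrow> \<bar>antisym_copula u v - product_copula u v\<bar>)"
      unfolding antisym_copula_minus_transpose abs_mult by (simp add: case_prod_beta)
    ultimately show "(case x of (u, v) \<Rightarrow> \<bar>antisym_copula u v - product_copula u v\<bar>)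
        \<le> (SUP x\<in>{0..1} \<times> {0..1}. ?d x) / 2"
      by linarith
  qed auto
  then show ?thesis using PInf by (simp add: nonexch_measure_def copula_dist_def)
qed (use assms in auto)

text \<open>Strictness matters for sharpness: at distance 0 the inequality would read
  \<open>0 \<le> 0\<close> and exclude no constant.\<close>

lemma copula_dist_antisym_copula_pos:
  assumes "1 \<le> p"
  shows "0 < copula_dist p antisym_copula product_copula"
proof -
  let ?Q = "{0..1} \<times> {0..1} :: (real \<times> real) set"
  have Q: "?Q = cbox (0, 0) (1, 1)" by (simp add: cbox_Pair_eq)
  \<comment> \<open>An interior point off the diagonal, where no factor of the perturbation
    vanishes.\<close>
  have pt: "(1/2, 1/4) \<in> ?Q" by simp
  have neq: "antisym_copula (1/2) (1/4) - product_copula (1/2) (1/4) \<noteq> 0"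
    by (simp add: antisym_copula_def product_copula_def)
  note cont = continuous_on_copula[OF is_copula_antisym_copula]
  show ?thesis
  proof (cases p)
    case (real r)
    then have r: "1 \<le> r" using assms by simp
    let ?f = "\<lambda>(u, v). \<bar>antisym_copula u v - product_copula u v\<bar> powr r"
    have cf: "continuous_on ?Q ?f"
      using continuous_on_abs_diff_powr[OF cont continuous_on_product_copula] r by simp
    \<comment> \<open>A continuous nonnegative function with integral 0 over a box with nonempty
      interior vanishes throughout it.\<close>
    have "set_lebesgue_integral lborel ?Q ?f \<noteq> 0"
    proof
      assume "set_lebesgue_integral lborel ?Q ?f = 0"
      with set_borel_integral_eq_integral[OF set_integrable_unit_square[OF cf]]
      have "?f integrable_on ?Q" "integral ?Q ?f = 0" by auto
      then have "(?f has_integral 0) (cbox (0, 0) (1, 1))"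
        by (simp add: has_integral_integrable_integral Q)
      moreover have "box (0, 0) (1, 1) \<noteq> ({} :: (real \<times> real) set)"
        by (simp add: box_ne_empty Basis_prod_def ball_Un)
      ultimately have "?f (1/2, 1/4) = 0"
        using cf pt unfolding Q
        by (intro has_integral_0_cbox_imp_0[of "(0, 0)" "(1, 1)" ?f]) (auto simp: case_prod_beta)
      then show False using neq by simp
    qed
    moreover have "0 \<le> set_lebesgue_integral lborel ?Q ?f"
      by (simp_all add: set_integral_abs_powr_nonneg)
    ultimately show ?thesis using real by (simp add: copula_dist_def)
  next
    case PInf
    let ?d = "\<lambda>(u, v). \<bar>antisym_copula u v - product_copula u v\<bar>"
    have bdd: "bdd_above (?d ` ?Q)"
      using cont continuous_on_product_copula unfolding case_prod_beta
      by (intro compact_imp_bounded[THEN bounded_imp_bdd_above] compact_continuous_image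
          continuous_intros compact_Times compact_Icc) auto
    have "0 < ?d (1/2, 1/4)" using neq by simp
    also have "\<dots> \<le> (SUP x\<in>?Q. ?d x)" by (rule cSUP_upper[OF pt bdd])
    finally show ?thesis using PInf by (simp add: copula_dist_def)
  qed (use assms in auto)
qed

theorem proposition1:
  fixes p :: ereal
  assumes "1 \<le> p"
  shows "(\<forall>C. is_copula C \<longrightarrow> nonexch_measure p C \<le> 2 / sw_const p * sw_measure p C) \<and>
         (\<forall>K. K < 2 / sw_const p \<longrightarrow>
            \<not> (\<forall>C. is_copula C \<longrightarrow> nonexch_measure p C \<le> K * sw_measure p C))"
proof (intro conjI allI impI)
  fix C assume "is_copula C"
  then show "nonexch_measure p C \<le> 2 / sw_const p * sw_measure p C"
    using nonexch_measure_le[OF assms] sw_const_pos[OF assms] by (simp add: sw_measure_def)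
next
  fix K assume K: "K < 2 / sw_const p"
  let ?d = "copula_dist p antisym_copula product_copula"
  \<comment> \<open>This product is the factor of \<open>?d\<close> once \<open>sw_measure\<close>
    is unfolded, and it lies strictly below the ratio 2 attained by
    \<open>antisym_copula\<close>.\<close>
  have "K * sw_const p < 2" using K sw_const_pos[OF assms] by (simp add: field_simps)
  then have "K * sw_measure p antisym_copula < 2 * ?d"
    using copula_dist_antisym_copula_pos[OF assms] by (simp add: sw_measure_def)
  also have "\<dots> \<le> nonexch_measure p antisym_copula"
    by (rule nonexch_measure_antisym_copula[OF assms])
  finally show "\<not> (\<forall>C. is_copula C \<longrightarrow> nonexch_measure p C \<le> K * sw_measure p C)"
    using is_copula_antisym_copula by (auto simp: not_le)
qed

end
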